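(* Let $A^n$ ($n>2$) be an apic graph. Then $\pi_{fl}(A^n)\le 8$.
   Context: An apic graph $A^n$, $n>2$, is a plane graph on $2n$ vertices with $2(n-1)$ triangular faces and one $2n$-gonal face, obtained from the ladder graph $L_n=P_n\square P_2$ (standard plane embedding) by adding one diagonal edge inside each quadrangular face so that no vertex of the resulting graph has degree greater than 4. A sequence $r_1\dots r_{2n}$ is a repetition if $r_i=r_{n+i}$ for all $i\le n$. In a plane graph $G$, a facial path is a path whose vertices and edges are consecutive on the boundary walk of some face of $G$. A vertex colouring is facial non-repetitive if no facial path on vertices $v_1,\dots,v_{2n}$ ($n\ge1$) has colour sequence that is a repetition. $\pi_{fl}(G)$ is the minimum $l$ such that for every assignment of lists $L(v)\subseteq\mathbb{Z}_+$ with $|L(v)|\ge l$ there is a facial non-repetitive colouring $\varphi$ with $\varphi(v)\in L(v)$ for every vertex $v$. *)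

theory Defs
  imports "HOL-Analysis.Analysis" "HOL-Library.Sublist" "HOL-Library.Extended_Nat"
begin

section \<open>Plane graphs\<close>

text \<open>
  Plane graphs are given by straight-line drawings: the vertices are points of the plane
  (identified with the complex numbers), and an edge \<open>{u, v}\<close> is drawn as the segment from
  \<open>u\<close> to \<open>v\<close>, that is, as the convex hull of \<open>{u, v}\<close>.
\<close>

record geom_graph =
  verts :: "complex set"
  edges :: "complex set set"

definition plane_graph :: "geom_graph \<Rightarrow> bool" where
  "plane_graph G \<longleftrightarrow>
     finite (verts G) \<and>
     (\<forall>e\<in>edges G. \<exists>u\<in>verts G. \<exists>v\<in>verts G. u \<noteq> v \<and> e = {u, v}) \<and>
     (\<forall>e\<in>edges G. (convex hull e - e) \<inter> verts G = {}) \<and>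
     (\<forall>e\<in>edges G. \<forall>e'\<in>edges G. e \<noteq> e' \<longrightarrow> (convex hull e - e) \<inter> convex hull e' = {})"

definition degree :: "geom_graph \<Rightarrow> complex \<Rightarrow> nat" where
  "degree G v = card {e \<in> edges G. v \<in> e}"

definition drawing :: "geom_graph \<Rightarrow> complex set" where
  "drawing G = verts G \<union> (\<Union>e\<in>edges G. convex hull e)"

definition faces :: "geom_graph \<Rightarrow> complex set set" where
  "faces G = components (- drawing G)"

text \<open>
  The counterclockwise angle from the direction \<open>a\<close> to the direction \<open>b\<close>, in the interval
  \<open>(0, 2\<pi>]\<close>; equal directions enclose the full angle, which is what is needed when a walk
  turns back at a vertex of degree 1.
\<close>

definition ccw_angle :: "complex \<Rightarrow> complex \<Rightarrow> real" where
  "ccw_angle a b = (if Arg2pi (b / a) = 0 then 2 * pi else Arg2pi (b / a))"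

text \<open>
  \<open>left_corner F u v w\<close>: when a walk passes \<open>u, v, w\<close>, the region \<open>F\<close> fills, close to \<open>v\<close>,
  the whole open angular sector on the left of the walk.  This sector extends
  counterclockwise from the direction of \<open>w\<close> to the direction of \<open>u\<close>, as seen from \<open>v\<close>.
\<close>

definition left_corner :: "complex set \<Rightarrow> complex \<Rightarrow> complex \<Rightarrow> complex \<Rightarrow> bool" where
  "left_corner F u v w \<longleftrightarrow>
     (\<exists>\<epsilon>>0. \<forall>r t. 0 < r \<and> r < \<epsilon> \<and> 0 < t \<and> t < ccw_angle (w - v) (u - v) \<longrightarrow>
        v + complex_of_real r * cis t * sgn (w - v) \<in> F)"

text \<open>
  A boundary walk of \<open>F\<close> is a cyclic sequence of vertices (the last one is followed by the
  first one) that follows the edges and keeps \<open>F\<close> on its left all the way.  A bridge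
  may be used once in each direction, but no edge is used twice in the same direction, so
  the boundary is traversed only once.
\<close>

definition boundary_walk :: "geom_graph \<Rightarrow> complex set \<Rightarrow> complex list \<Rightarrow> bool" where
  "boundary_walk G F ws \<longleftrightarrow>
     ws \<noteq> [] \<and>
     distinct (zip ws (rotate1 ws)) \<and>
     (\<forall>i < length ws.
        let u = ws ! i;
            v = ws ! ((i + 1) mod length ws);
            w = ws ! ((i + 2) mod length ws)
        in {u, v} \<in> edges G \<and> left_corner F u v w)"

text \<open>
  A path is given by its vertices.  The reversal accounts for traversing the
  boundary with the face on the right.
\<close>

definition facial_path :: "geom_graph \<Rightarrow> complex list \<Rightarrow> bool" where
  "facial_path G xs \<longleftrightarrow>
     distinct xs \<and>
     (\<exists>F\<in>faces G. \<exists>ws k. boundary_walk G F ws \<and>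
        (prefix xs (rotate k ws) \<or> prefix (rev xs) (rotate k ws)))"


section \<open>Facial non-repetitive list colourings\<close>

definition repetition :: "'a list \<Rightarrow> bool" where
  "repetition rs \<longleftrightarrow> (\<exists>n\<ge>1. length rs = 2 * n \<and> (\<forall>i<n. rs ! i = rs ! (n + i)))"

definition facial_nonrepetitive :: "geom_graph \<Rightarrow> (complex \<Rightarrow> nat) \<Rightarrow> bool" where
  "facial_nonrepetitive G \<phi> \<longleftrightarrow> (\<forall>xs. facial_path G xs \<longrightarrow> \<not> repetition (map \<phi> xs))"

text \<open>Infinite lists are admitted; they satisfy every lower bound on the size.\<close>

definition facial_choosable :: "geom_graph \<Rightarrow> nat \<Rightarrow> bool" where
  "facial_choosable G l \<longleftrightarrow>
     (\<forall>L :: complex \<Rightarrow> nat set.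
        (\<forall>v\<in>verts G. L v \<subseteq> {1..} \<and> (finite (L v) \<longrightarrow> l \<le> card (L v))) \<longrightarrow>
        (\<exists>\<phi>. facial_nonrepetitive G \<phi> \<and> (\<forall>v\<in>verts G. \<phi> v \<in> L v)))"

text \<open>The value is \<open>\<infinity>\<close> if there is no suitable \<open>l\<close>.\<close>

definition pi_fl :: "geom_graph \<Rightarrow> enat" where
  "pi_fl G = (INF l\<in>{l. facial_choosable G l}. enat l)"


section \<open>Apic graphs\<close>

definition pt :: "nat \<Rightarrow> nat \<Rightarrow> complex" where
  "pt i j = Complex (real i) (real j)"

definition ladder :: "nat \<Rightarrow> geom_graph" where
  "ladder n = \<lparr>
     verts = {pt i j | i j. i < n \<and> j < 2},
     edges = {{pt i 0, pt i 1} | i. i < n} \<union>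
             {{pt i j, pt (i + 1) j} | i j. i + 1 < n \<and> j < 2} \<rparr>"

text \<open>The diagonals of the quadrangular face between the columns \<open>i\<close> and \<open>i + 1\<close>.\<close>

definition diagonals :: "nat \<Rightarrow> complex set set" where
  "diagonals i = {{pt i 0, pt (i + 1) 1}, {pt i 1, pt (i + 1) 0}}"

definition apic_graph :: "nat \<Rightarrow> geom_graph \<Rightarrow> bool" where
  "apic_graph n G \<longleftrightarrow>
     (\<exists>d. (\<forall>i. i + 1 < n \<longrightarrow> d i \<in> diagonals i) \<and>
          G = \<lparr> verts = verts (ladder n),
                edges = edges (ladder n) \<union> d ` {i. i + 1 < n} \<rparr>) \<and>
     (\<forall>v\<in>verts G. degree G v \<le> 4)"

lemma in_hull_iff:
  "z \<in> convex hull {u, v} \<longleftrightarrow>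
     (\<exists>t. 0 \<le> t \<and> t \<le> 1 \<and> Re z = (1 - t) * Re u + t * Re v \<and> Im z = (1 - t) * Im u + t * Im v)"
  by (auto simp flip: segment_convex_hull simp: in_segment complex_eq_iff)

lemma hull_rung:
  "z \<in> convex hull {pt i 0, pt i 1} \<longleftrightarrow> Re z = real i \<and> 0 \<le> Im z \<and> Im z \<le> 1"
  unfolding in_hull_iff pt_def by (auto simp: algebra_simps)

lemma hull_step:
  "z \<in> convex hull {pt i j, pt (i + 1) k} \<longleftrightarrow>
     real i \<le> Re z \<and> Re z \<le> real i + 1 \<and>
     Im z = real j + (Re z - real i) * (real k - real j)"
  unfolding in_hull_iff pt_def
  by (auto simp: algebra_simps intro!: exI[of _ "Re z - real i"])

lemma pt_eq_iff [simp]: "pt i j = pt i' j' \<longleftrightarrow> i = i' \<and> j = j'"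
  by (simp add: pt_def)

lemma apic_graph_plane:
  assumes "apic_graph n G"
  shows "plane_graph G"
proof -
  obtain d where d: "\<And>i. i + 1 < n \<Longrightarrow> d i \<in> diagonals i"
    and G: "G = \<lparr> verts = verts (ladder n),
                  edges = edges (ladder n) \<union> d ` {i. i + 1 < n} \<rparr>"
    using assms unfolding apic_graph_def by blast
  have V: "verts G = {pt i j | i j. i < n \<and> j < 2}"
    by (simp add: G ladder_def)
  have V': "verts G = (\<lambda>(i, j). pt i j) ` ({..<n} \<times> {..<2})"
    by (auto simp: V)
  have fin: "finite (verts G)" unfolding V' by simp
  have E: "(\<exists>i<n. e = {pt i 0, pt i 1}) \<or>
      (\<exists>i j k. i + 1 < n \<and> j < 2 \<and> k < 2 \<and> e = {pt i j, pt (i + 1) k} \<and> (j \<noteq> k \<longrightarrow> e = d i))"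
    if "e \<in> edges G" for e
  proof -
    from that consider i where "i < n" "e = {pt i 0, pt i 1}"
      | i j where "i + 1 < n" "j < 2" "e = {pt i j, pt (i + 1) j}"
      | i where "i + 1 < n" "e = d i"
      unfolding G ladder_def by auto
    then show ?thesis
    proof cases
      case 1 then show ?thesis by blast
    next
      case 2 then show ?thesis by blast
    next
      case 3
      have "\<exists>j k. j < 2 \<and> k < 2 \<and> d i = {pt i j, pt (i + 1) k}"
        using d[OF 3(1)] unfolding diagonals_def
        by (metis insert_iff lessI numeral_2_eq_2 one_less_numeral_iff pos2 semiring_norm(76) singletonD)
      then show ?thesis using 3 by blast
    qed
  qed
  have int_rung: "Re z = real i \<and> 0 < Im z \<and> Im z < 1"
    if "z \<in> convex hull {pt i 0, pt i 1} - {pt i 0, pt i 1}" for z i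
    using that unfolding Diff_iff hull_rung by (auto simp: pt_def complex_eq_iff)
  have int_step: "real i < Re z \<and> Re z < real i + 1 \<and>
      Im z = real j + (Re z - real i) * (real k - real j)"
    if "z \<in> convex hull {pt i j, pt (i + 1) k} - {pt i j, pt (i + 1) k}" for z i j k
  proof -
    from that have h: "real i \<le> Re z" "Re z \<le> real i + 1"
        "Im z = real j + (Re z - real i) * (real k - real j)"
      and ne: "z \<noteq> pt i j" "z \<noteq> pt (i + 1) k"
      unfolding Diff_iff hull_step by auto
    have "Re z \<noteq> real i" using h ne by (auto simp: pt_def complex_eq_iff)
    moreover have "Re z \<noteq> real i + 1" using h ne by (auto simp: pt_def complex_eq_iff)
    ultimately show ?thesis using h by auto
  qed
  have step_step: "j = j' \<and> k = k' \<or> j \<noteq> k \<and> j' \<noteq> k'"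
    if "0 < t" "t < 1" "j < 2" "k < 2" "j' < 2" "k' < 2"
      "real j + t * (real k - real j) = real j' + t * (real k' - real j')"
    for t j k j' k'
    using that by (auto simp: less_2_cases_iff)
  have between: False if "real i < x" "x < real i + 1" "x = real m" for i m x
  proof -
    have "i < m" "m < i + 1" using that by linarith+
    then show False by simp
  qed
  have disj: "(convex hull e - e) \<inter> convex hull e' = {}"
    if e: "e \<in> edges G" and e': "e' \<in> edges G" and ne: "e \<noteq> e'" for e e'
  proof (rule ccontr)
    assume "(convex hull e - e) \<inter> convex hull e' \<noteq> {}"
    then obtain z where z: "z \<in> convex hull e - e" and z': "z \<in> convex hull e'" by blast
    from E[OF e] show False
    proof (elim disjE exE conjE)
      fix i assume ei: "e = {pt i 0, pt i 1}"
      note zi = int_rung[OF z[unfolded ei]]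
      from E[OF e'] show False
      proof (elim disjE exE conjE)
        fix i' assume "e' = {pt i' 0, pt i' 1}"
        with z' zi ne ei show False by (auto simp: hull_rung simp del: One_nat_def)
      next
        fix i' j k assume "j < 2" "k < 2" "e' = {pt i' j, pt (i' + 1) k}"
        with z' have h: "real i' \<le> Re z" "Re z \<le> real i' + 1"
          "Im z = real j + (Re z - real i') * (real k - real j)" by (auto simp only: hull_step)
        from h zi have "i = i' \<or> i = i' + 1" by linarith
        with h zi have "Im z = real j \<or> Im z = real k" by auto
        with zi \<open>j < 2\<close> \<open>k < 2\<close> show False by (auto simp: less_2_cases_iff)
      qed
    next
      fix i j k assume i: "j < 2" "k < 2" "e = {pt i j, pt (i + 1) k}" "j \<noteq> k \<longrightarrow> e = d i"
      note zi = int_step[OF z[unfolded i(3)]]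
      from E[OF e'] show False
      proof (elim disjE exE conjE)
        fix i' assume "e' = {pt i' 0, pt i' 1}"
        with z' have "Re z = real i'" by (auto simp only: hull_rung)
        with zi between show False by blast
      next
        fix i' j' k' assume i': "j' < 2" "k' < 2" "e' = {pt i' j', pt (i' + 1) k'}"
          "j' \<noteq> k' \<longrightarrow> e' = d i'"
        with z' have h: "real i' \<le> Re z" "Re z \<le> real i' + 1"
          "Im z = real j' + (Re z - real i') * (real k' - real j')" by (auto simp only: hull_step)
        from h zi have "i = i'" by linarith
        with step_step[of "Re z - real i" j k j' k'] h zi i i' ne show False by auto
      qed
    qed
  qed
  have vert: "(convex hull e - e) \<inter> verts G = {}" if e: "e \<in> edges G" for e
  proof (rule ccontr)
    assume "(convex hull e - e) \<inter> verts G \<noteq> {}"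
    then obtain a b where z: "pt a b \<in> convex hull e - e" unfolding V by blast
    from E[OF e] show False
    proof (elim disjE exE conjE)
      fix i assume ei: "e = {pt i 0, pt i 1}"
      from int_rung[OF z[unfolded ei]] show False by (auto simp: pt_def)
    next
      fix i j k assume ei: "e = {pt i j, pt (i + 1) k}"
      from int_step[OF z[unfolded ei]] show False by (auto simp: pt_def)
    qed
  qed
  have ends_ok: "\<exists>u\<in>verts G. \<exists>v\<in>verts G. u \<noteq> v \<and> e = {u, v}" if e: "e \<in> edges G" for e
    using E[OF e]
  proof (elim disjE exE conjE)
    fix i assume "i < n" "e = {pt i 0, pt i 1}"
    then show ?thesis unfolding V
      by (intro bexI[of _ "pt i 0"] bexI[of _ "pt i 1"]) auto
  next
    fix i j k assume "i + 1 < n" "j < 2" "k < 2" "e = {pt i j, pt (i + 1) k}"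
    then show ?thesis unfolding V
      by (intro bexI[of _ "pt i j"] bexI[of _ "pt (i + 1) k"]) auto
  qed
  show ?thesis
    unfolding plane_graph_def using fin ends_ok vert disj by blast
qed

lemma apic_graph_exists: "\<exists>G. apic_graph n G"
proof -
  define d where "d i = {pt i 0, pt (i + 1) 1}" for i
  define G where "G = \<lparr> verts = verts (ladder n),
                        edges = edges (ladder n) \<union> d ` {i. i + 1 < n} \<rparr>"
  have "degree G v \<le> 4" if "v \<in> verts G" for v
  proof -
    from that obtain i j where v: "v = pt i j" and j: "j = 0 \<or> j = 1"
      by (auto simp: G_def ladder_def less_2_cases_iff)
    let ?es = "[{pt i 0, pt i 1}, {pt i j, pt (i + 1) j}, {pt (i - 1) j, pt i j},
                if j = 0 then d i else d (i - 1)]"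
    have sub: "{e \<in> edges G. v \<in> e} \<subseteq> set ?es"
    proof
      fix e assume "e \<in> {e \<in> edges G. v \<in> e}"
      then have ve: "v \<in> e" and "e \<in> edges G" by auto
      then consider i' where "e = {pt i' 0, pt i' 1}"
        | i' j' where "e = {pt i' j', pt (i' + 1) j'}"
        | i' where "e = d i'"
        unfolding G_def ladder_def by auto
      then show "e \<in> set ?es"
      proof cases
        case 1
        then have "i' = i" using ve by (auto simp: v)
        then show ?thesis using 1 by auto
      next
        case 2
        then have "j' = j" and "i = i' \<or> i = i' + 1" using ve by (auto simp: v)
        then show ?thesis using 2 by auto
      next
        case 3
        then have "j = 0 \<and> i = i' \<or> j = 1 \<and> i = i' + 1" using ve by (auto simp: v d_def)
        then show ?thesis using 3 by auto
      qed
    qed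
    have "degree G v \<le> card (set ?es)"
      unfolding degree_def by (rule card_mono[OF _ sub]) simp
    also have "\<dots> \<le> length ?es" by (rule card_length)
    also have "\<dots> = 4" by simp
    finally show ?thesis .
  qed
  then have "apic_graph n G"
    unfolding apic_graph_def by (intro conjI exI[of _ d]) (auto simp: G_def d_def diagonals_def)
  then show ?thesis by blast
qed

end

theory Submission
  imports Defs
begin

text \<open>
  The outer face of an apic graph is bounded by a cycle through all \<open>2n\<close> vertices and every other
  face is a triangle, so a colouring is facial non-repetitive as soon as it is proper and no path on
  the outer cycle with at least four vertices is a repetition.  Such a colouring is found by
  counting.  Let \<open>C(I)\<close> be the number of suitable list colourings of an interval \<open>I\<close> of the cycle.
  Adding a vertex \<open>v\<close> at an end of \<open>I\<close>, at most four of its eight colours are lost to neighbours,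
  and a repetition of half-length \<open>k \<ge> 2\<close> through \<open>v\<close> is determined by its restriction to
  \<open>I + v\<close> without the half containing \<open>v\<close>.  Hence \<open>C(I + v) \<ge> 4 C(I) - \<Sum>\<^sub>k C(I + v - k)\<close>, which
  gives \<open>C(I + v) \<ge> 3 C(I)\<close> by induction.  Closing the cycle, there are \<open>2k - 1\<close> positions for a
  repetition of half-length \<open>k\<close> across the seam, each met by at most \<open>3\<^sup>-\<^sup>k C\<close> of the colourings, and
  \<open>\<Sum>\<^sub>k\<^sub>\<ge>\<^sub>2 (2k - 1) 3\<^sup>-\<^sup>k = 2/3 < 1\<close>.

  No Jordan curve argument is needed for the faces: a face avoids the drawing, so at each corner of
  a boundary walk no edge enters the sector on the left, and this already determines the walk.
\<close>

section \<open>Counting list colourings of intervals of a cycle\<close>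

text \<open>Extensional functions make this a finite set, so it can be counted. Half-length 1 is
  left to \<open>E\<close>, which in the application contains every edge of the graph. Only runs of
  consecutive naturals are tested; repetitions across the seam of the cycle are removed
  later.\<close>

definition good_colourings :: "(nat \<Rightarrow> 'c set) \<Rightarrow> (nat \<Rightarrow> nat \<Rightarrow> bool) \<Rightarrow> nat set \<Rightarrow> (nat \<Rightarrow> 'c) set" where
  "good_colourings L E S = {f \<in> Pi\<^sub>E S L. (\<forall>p\<in>S. \<forall>q\<in>S. E p q \<longrightarrow> f p \<noteq> f q) \<and>
     (\<forall>s k. 2 \<le> k \<longrightarrow> {s..<s + 2 * k} \<subseteq> S \<longrightarrow> (\<exists>i<k. f (s + i) \<noteq> f (s + k + i)))}"

lemma restrict_good_colourings:
  assumes "f \<in> good_colourings L E S" "T \<subseteq> S"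
  shows "restrict f T \<in> good_colourings L E T"
proof -
  have "\<exists>i<k. restrict f T (s + i) \<noteq> restrict f T (s + k + i)"
    if k: "2 \<le> k" and sub: "{s..<s + 2 * k} \<subseteq> T" for s k
  proof -
    obtain i where i: "i < k" "f (s + i) \<noteq> f (s + k + i)"
      using assms k sub unfolding good_colourings_def by blast
    have "s + i \<in> T" "s + k + i \<in> T" using i(1) sub by auto
    then show ?thesis using i by (intro exI[of _ i]) simp
  qed
  then show ?thesis
    using assms unfolding good_colourings_def by (auto simp: PiE_iff subset_iff)
qed

lemma finite_good_colourings:
  assumes "finite S" "\<And>p. p \<in> S \<Longrightarrow> finite (L p)"
  shows "finite (good_colourings L E S)"
  by (rule finite_subset[OF _ finite_PiE[OF assms]]) (auto simp: good_colourings_def)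

text \<open>Restriction to \<open>U\<close> is injective on \<open>A\<close>, because each value
  outside \<open>U\<close> is copied from inside. In the uses, \<open>\<sigma>\<close> shifts by the
  half-length of a repetition and \<open>U\<close> is what remains after deleting one half.\<close>

lemma card_determined_le:
  assumes "finite (good_colourings L E U)" "A \<subseteq> Pi\<^sub>E T L"
    and "\<And>f. f \<in> A \<Longrightarrow> restrict f U \<in> good_colourings L E U"
    and "\<And>f x. f \<in> A \<Longrightarrow> x \<in> T - U \<Longrightarrow> f x = f (\<sigma> x)"
    and "\<And>x. x \<in> T - U \<Longrightarrow> \<sigma> x \<in> U"
  shows "card A \<le> card (good_colourings L E U)"
proof (rule card_inj_on_le[OF _ _ assms(1)])
  show "inj_on (\<lambda>f. restrict f U) A"
  proof (rule inj_onI)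
    fix f g assume fg: "f \<in> A" "g \<in> A" and eq: "restrict f U = restrict g U"
    have U: "f x = g x" if "x \<in> U" for x
      using fun_cong[OF eq, of x] that by simp
    show "f = g"
    proof (rule PiE_ext)
      show "f \<in> Pi\<^sub>E T L" "g \<in> Pi\<^sub>E T L" using fg assms(2) by auto
      fix x assume "x \<in> T"
      then show "f x = g x"
        using U assms(4)[OF fg(1), of x] assms(4)[OF fg(2), of x] assms(5)[of x] by (cases "x \<in> U") auto
    qed
  qed
  show "(\<lambda>f. restrict f U) ` A \<subseteq> good_colourings L E U" using assms(3) by blast
qed

lemma card_good_colourings_insert:
  fixes L :: "nat \<Rightarrow> 'c set"
  assumes fin: "finite S" "\<And>p. p \<in> insert v S \<Longrightarrow> finite (L p)" and v: "v \<notin> S"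
    and L: "8 \<le> card (L v)" and deg: "card {q\<in>S. E v q} \<le> 4"
    and E: "\<And>p q. E p q \<Longrightarrow> E q p" "\<not> E v v"
    and K: "finite K" "\<And>j. j \<in> K \<Longrightarrow> U j \<subseteq> S"
    and \<sigma>: "\<And>j x. j \<in> K \<Longrightarrow> x \<in> insert v S - U j \<Longrightarrow> \<sigma> j x \<in> U j"
    and rep: "\<And>(f :: nat \<Rightarrow> 'c) s k. 2 \<le> k \<Longrightarrow> v \<in> {s..<s + 2 * k} \<Longrightarrow> {s..<s + 2 * k} \<subseteq> insert v S \<Longrightarrow>
       (\<And>i. i < k \<Longrightarrow> f (s + i) = f (s + k + i)) \<Longrightarrow>
       \<exists>j\<in>K. \<forall>x\<in>insert v S - U j. f x = f (\<sigma> j x)"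
  shows "4 * card (good_colourings L E S) \<le>
    card (good_colourings L E (insert v S)) + (\<Sum>j\<in>K. card (good_colourings L E (U j)))"
proof -
  define X where "X = (SIGMA f:good_colourings L E S. L v - f ` {q\<in>S. E v q})"
  define B where "B j = {f \<in> Pi\<^sub>E (insert v S) L. restrict f S \<in> good_colourings L E S \<and>
     (\<forall>x\<in>insert v S - U j. f x = f (\<sigma> j x))}" for j
  let ?h = "\<lambda>(f, c). f(v := c)"
  have finG: "finite (good_colourings L E W)" if "W \<subseteq> insert v S" for W
    using finite_good_colourings[of W L E] finite_subset[OF that] fin that by auto
  have inj: "inj_on ?h X"
  proof (rule inj_onI, clarify)
    fix f c g e assume "(f, c) \<in> X" "(g, e) \<in> X" and eq: "f(v := c) = g(v := e)"
    then have fg: "f \<in> Pi\<^sub>E S L" "g \<in> Pi\<^sub>E S L" by (auto simp: X_def good_colourings_def)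
    have "f x = g x" if "x \<in> S" for x
      using fun_cong[OF eq, of x] that v by (auto split: if_splits)
    then show "f = g \<and> c = e" using PiE_ext[OF fg] fun_cong[OF eq, of v] by auto
  qed
  have "4 \<le> card (L v - f ` {q\<in>S. E v q})" for f
  proof -
    have "card (f ` {q\<in>S. E v q}) \<le> 4"
      using card_image_le[of "{q\<in>S. E v q}" f] fin(1) deg by auto
    then show ?thesis using diff_card_le_card_Diff[of "f ` {q\<in>S. E v q}" "L v"] fin L by auto
  qed
  then have "4 * card (good_colourings L E S) \<le>
      (\<Sum>f\<in>good_colourings L E S. card (L v - f ` {q\<in>S. E v q}))"
    using sum_mono[of "good_colourings L E S" "\<lambda>_. 4 :: nat"] by (simp add: mult.commute)
  also have "\<dots> = card X"
    unfolding X_def by (rule card_SigmaI[symmetric]) (use finG fin in auto)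
  also have "\<dots> = card (?h ` X)" using card_image[OF inj] by simp
  also have "\<dots> \<le> card (good_colourings L E (insert v S) \<union> (\<Union>j\<in>K. B j))"
  proof (rule card_mono)
    have "finite (B j)" for j
      by (rule finite_subset[of _ "Pi\<^sub>E (insert v S) L"]) (use fin in \<open>auto simp: B_def intro!: finite_PiE\<close>)
    then show "finite (good_colourings L E (insert v S) \<union> (\<Union>j\<in>K. B j))"
      using finG[of "insert v S"] K by auto
    show "?h ` X \<subseteq> good_colourings L E (insert v S) \<union> (\<Union>j\<in>K. B j)"
    proof clarify
      fix f c assume X: "(f, c) \<in> X" and nB: "f(v := c) \<notin> (\<Union>j\<in>K. B j)"
      let ?g = "f(v := c)"
      have f: "f \<in> good_colourings L E S" and c: "c \<in> L v" "c \<notin> f ` {q\<in>S. E v q}"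
        using X by (auto simp: X_def)
      have gP: "?g \<in> Pi\<^sub>E (insert v S) L"
        using f c by (auto simp: good_colourings_def PiE_iff extensional_def)
      have "restrict ?g S = f"
        using f v by (auto simp: good_colourings_def PiE_iff extensional_def restrict_def)
      then have nrep: False if "j \<in> K" "\<forall>x\<in>insert v S - U j. ?g x = ?g (\<sigma> j x)" for j
        using that nB gP f by (auto simp: B_def)
      have "?g p \<noteq> ?g q" if pq: "p \<in> insert v S" "q \<in> insert v S" "E p q" for p q
      proof -
        consider "p = v" "q = v" | "p = v" "q \<in> S" "q \<noteq> v" | "q = v" "p \<in> S" "p \<noteq> v"
          | "p \<in> S" "q \<in> S" "p \<noteq> v" "q \<noteq> v"
          using pq by blast
        then show ?thesis
          by cases (use pq E c f in \<open>auto simp: good_colourings_def\<close>)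
      qed
      moreover have "\<exists>i<k. ?g (s + i) \<noteq> ?g (s + k + i)"
        if k: "2 \<le> k" "{s..<s + 2 * k} \<subseteq> insert v S" for s k
      proof (rule ccontr)
        assume r: "\<not> ?thesis"
        show False
        proof (cases "v \<in> {s..<s + 2 * k}")
          case True
          then show False using rep[of k s ?g] k r nrep by blast
        next
          case False
          then have "{s..<s + 2 * k} \<subseteq> S" using k by blast
          then obtain i where i: "i < k" "f (s + i) \<noteq> f (s + k + i)"
            using f k unfolding good_colourings_def by blast
          then have "s + i \<noteq> v" "s + k + i \<noteq> v" using False by auto
          then show False using r i by auto
        qed
      qed
      ultimately show "?g \<in> good_colourings L E (insert v S)"
        using gP unfolding good_colourings_def by blast
    qed
  qed
  also have "\<dots> \<le> card (good_colourings L E (insert v S)) + card (\<Union>j\<in>K. B j)"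
    by (rule card_Un_le)
  also have "card (\<Union>j\<in>K. B j) \<le> (\<Sum>j\<in>K. card (B j))"
    using K(1) by (rule card_UN_le)
  also have "\<dots> \<le> (\<Sum>j\<in>K. card (good_colourings L E (U j)))"
  proof (rule sum_mono)
    fix j assume j: "j \<in> K"
    show "card (B j) \<le> card (good_colourings L E (U j))"
    proof (rule card_determined_le[where T = "insert v S" and \<sigma> = "\<sigma> j"])
      show "finite (good_colourings L E (U j))" using K(2)[OF j] by (intro finG) auto
      fix f assume f: "f \<in> B j"
      then have "restrict (restrict f S) (U j) \<in> good_colourings L E (U j)"
        using K(2)[OF j] by (intro restrict_good_colourings) (auto simp: B_def)
      moreover have "S \<inter> U j = U j" using K(2)[OF j] by auto
      ultimately show "restrict f (U j) \<in> good_colourings L E (U j)" by simp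
    qed (use \<sigma>[OF j] in \<open>auto simp: B_def\<close>)
  qed
  finally show ?thesis by simp
qed

section \<open>Numerical estimates: growth by a factor 3 and the seam sum\<close>

text \<open>By induction \<open>c (Suc m - k)\<close> is at most \<open>c m\<close> divided by
  \<open>3 ^ (k - 1)\<close>. The subtracted sum is therefore at most \<open>c m\<close> times a
  geometric sum below 1/2; the cruder factor 1 gives 4 - 1 = 3.\<close>

lemma recurrence_growth:
  fixes c :: "nat \<Rightarrow> real"
  assumes "\<And>m. 0 \<le> c m"
    and "\<And>m. m < M \<Longrightarrow> 4 * c m \<le> c (Suc m) + (\<Sum>k=2..Suc m. c (Suc m - k))"
  shows "m < M \<Longrightarrow> 3 * c m \<le> c (Suc m)"
proof (induction m rule: less_induct)
  case (less m)
  have pow: "c i * 3 ^ (m - i) \<le> c m" if "i \<le> m" for i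
  proof -
    have "j \<le> m \<longrightarrow> c i * 3 ^ (j - i) \<le> c j" if "i \<le> j" for j
      using that
    proof (induction j rule: dec_induct)
      case (step j)
      show ?case
      proof
        assume j: "Suc j \<le> m"
        have "c i * 3 ^ (Suc j - i) = 3 * (c i * 3 ^ (j - i))"
          using step(1) by (simp add: Suc_diff_le)
        also have "\<dots> \<le> 3 * c j" using step.IH j by simp
        also have "\<dots> \<le> c (Suc j)" using less.IH[of j] less.prems j by simp
        finally show "c i * 3 ^ (Suc j - i) \<le> c (Suc j)" .
      qed
    qed simp
    then show ?thesis using that by simp
  qed
  have "(\<Sum>k=2..Suc m. c (Suc m - k)) \<le> (\<Sum>k=2..Suc m. c m * (1 / 3) ^ (k - 1))"
  proof (rule sum_mono)
    fix k assume k: "k \<in> {2..Suc m}"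
    then have "m - (Suc m - k) = k - 1" "Suc m - k \<le> m" by auto
    then show "c (Suc m - k) \<le> c m * (1 / 3) ^ (k - 1)"
      using pow[of "Suc m - k"] k by (simp add: power_one_over divide_simps)
  qed
  also have "\<dots> = c m * (\<Sum>k=2..Suc m. (1 / 3) ^ (k - 1))" by (rule sum_distrib_left[symmetric])
  also have "(\<Sum>k=2..Suc m. (1 / 3 :: real) ^ (k - 1)) = (1 - (1 / 3) ^ m) / 2"
  proof (induction m)
    case (Suc m)
    have "(\<Sum>k=2..Suc (Suc m). (1 / 3 :: real) ^ (k - 1)) = (\<Sum>k=2..Suc m. (1 / 3) ^ (k - 1)) + (1 / 3) ^ Suc m"
      by simp
    then show ?case unfolding Suc.IH by (simp add: algebra_simps)
  qed simp
  also have "c m * \<dots> \<le> c m * 1" by (intro mult_left_mono assms) (auto intro: order_trans[of _ 0])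
  finally show ?case using assms(2)[OF less.prems] by simp
qed

text \<open>The weight \<open>2 * k - 1\<close> counts the starting positions of a run of length
  \<open>2 * k\<close> that crosses the seam. The closed form is for the strict bound: every partial
  sum stays below 2/3.\<close>

lemma sum_odd_thirds:
  "1 \<le> m \<Longrightarrow> (\<Sum>k=2..m. real (2 * k - 1) * (1 / 3) ^ k) = 2 / 3 - real (m + 1) * (1 / 3) ^ m"
proof (induction m rule: dec_induct)
  case (step m)
  then show ?case by (simp add: field_simps)
qed simp

section \<open>List colourings of a cycle with N positions\<close>

text \<open>Geometry is absent here: \<open>E\<close> is an abstract graph on the positions of the
  cycle. List size 8 minus degree 4 is the coefficient 4 of the recurrence.\<close>

locale list_instance =
  fixes N :: nat and L :: "nat \<Rightarrow> 'c set" and E :: "nat \<Rightarrow> nat \<Rightarrow> bool"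
  assumes finite_L: "\<And>p. p < N \<Longrightarrow> finite (L p)"
    and card_L: "\<And>p. p < N \<Longrightarrow> 8 \<le> card (L p)"
    and degree_E: "\<And>p. p < N \<Longrightarrow> card {q. q < N \<and> E p q} \<le> 4"
    and sym_E: "\<And>p q. E p q \<Longrightarrow> E q p"
    and irrefl_E: "\<And>p. \<not> E p p"
begin

abbreviation count :: "nat \<Rightarrow> nat \<Rightarrow> real" where
  "count a b \<equiv> real (card (good_colourings L E {a..<b}))"

lemma degree_E_subset: "p < N \<Longrightarrow> S \<subseteq> {..<N} \<Longrightarrow> card {q\<in>S. E p q} \<le> 4"
  by (rule order_trans[OF card_mono degree_E]) auto

lemma count_extend_right:
  assumes "a + m < N"
  shows "3 * count a (a + m) \<le> count a (a + Suc m)"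
proof (rule recurrence_growth[where M = "N - a"])
  fix m assume m: "m < N - a"
  \<comment> \<open>Half-lengths that fit into the extended interval; the sum is later enlarged to
    \<open>{2..Suc m}\<close> to match \<open>recurrence_growth\<close>.\<close>
  define K where "K = {k. 2 \<le> k \<and> 2 * k \<le> Suc m}"
  have K: "K \<subseteq> {2..Suc m}" by (auto simp: K_def)
  have deg: "card {q \<in> {a..<a + m}. E (a + m) q} \<le> 4"
    using m by (intro degree_E_subset) auto
  have ins: "{a..<a + Suc m} = insert (a + m) {a..<a + m}" by auto
  have "4 * card (good_colourings L E {a..<a + m}) \<le> card (good_colourings L E (insert (a + m) {a..<a + m})) +
      (\<Sum>k\<in>K. card (good_colourings L E {a..<a + (Suc m - k)}))"
  proof (rule card_good_colourings_insert[where \<sigma> = "\<lambda>k x. x - k"])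
    show "finite K" using K by (rule finite_subset) simp
    fix f :: "nat \<Rightarrow> 'c" and s k :: nat
    assume k: "2 \<le> k" "a + m \<in> {s..<s + 2 * k}" "{s..<s + 2 * k} \<subseteq> insert (a + m) {a..<a + m}"
      and r: "\<And>i. i < k \<Longrightarrow> f (s + i) = f (s + k + i)"
    \<comment> \<open>The run contains the new right end and stays inside the interval, so it ends
      exactly there and its second half consists of the last \<open>k\<close> positions.\<close>
    have "s \<in> {s..<s + 2 * k}" "s + 2 * k - 1 \<in> {s..<s + 2 * k}" using k(1) by auto
    with k(3) have "s \<in> insert (a + m) {a..<a + m}" "s + 2 * k - 1 \<in> insert (a + m) {a..<a + m}" by blast+
    then have s: "a \<le> s" "s + 2 * k = a + Suc m" using k(1,2) by auto
    have "f x = f (x - k)" if "x \<in> insert (a + m) {a..<a + m} - {a..<a + (Suc m - k)}" for x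
      using r[of "x - (s + k)"] that s by auto
    then show "\<exists>k\<in>K. \<forall>x\<in>insert (a + m) {a..<a + m} - {a..<a + (Suc m - k)}. f x = f (x - k)"
      using s k(1) by (intro bexI[of _ k]) (auto simp: K_def)
  qed (use m deg in \<open>auto simp: K_def finite_L card_L sym_E irrefl_E\<close>)
  also have "(\<Sum>k\<in>K. card (good_colourings L E {a..<a + (Suc m - k)})) \<le>
      (\<Sum>k=2..Suc m. card (good_colourings L E {a..<a + (Suc m - k)}))"
    by (rule sum_mono2) (use K in auto)
  finally show "4 * count a (a + m) \<le> count a (a + Suc m) + (\<Sum>k=2..Suc m. count a (a + (Suc m - k)))"
    unfolding ins by (simp flip: of_nat_sum)
qed (use assms in auto)

text \<open>Mirror image of \<open>count_extend_right\<close>. Growth to both sides is needed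
  because deleting a half at the seam can leave an interval in the middle of
  \<open>{0..<N}\<close>.\<close>

lemma count_extend_left:
  assumes "m < b" "b \<le> N"
  shows "3 * count (b - m) b \<le> count (b - Suc m) b"
proof (rule recurrence_growth[where M = b and c = "\<lambda>m. count (b - m) b"])
  fix m assume m: "m < b"
  define K where "K = {k. 2 \<le> k \<and> 2 * k \<le> Suc m}"
  have K: "K \<subseteq> {2..Suc m}" by (auto simp: K_def)
  let ?v = "b - Suc m"
  have deg: "card {q \<in> {b - m..<b}. E ?v q} \<le> 4"
    using m assms by (intro degree_E_subset) auto
  have ins: "{b - Suc m..<b} = insert ?v {b - m..<b}" using m by auto
  have "4 * card (good_colourings L E {b - m..<b}) \<le> card (good_colourings L E (insert ?v {b - m..<b})) +
      (\<Sum>k\<in>K. card (good_colourings L E {b - (Suc m - k)..<b}))"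
  proof (rule card_good_colourings_insert[where \<sigma> = "\<lambda>k x. x + k"])
    show "finite K" using K by (rule finite_subset) simp
    fix f :: "nat \<Rightarrow> 'c" and s k :: nat
    assume k: "2 \<le> k" "?v \<in> {s..<s + 2 * k}" "{s..<s + 2 * k} \<subseteq> insert ?v {b - m..<b}"
      and r: "\<And>i. i < k \<Longrightarrow> f (s + i) = f (s + k + i)"
    have "s \<in> {s..<s + 2 * k}" "s + 2 * k - 1 \<in> {s..<s + 2 * k}" using k(1) by auto
    with k(3) have "s \<in> insert ?v {b - m..<b}" "s + 2 * k - 1 \<in> insert ?v {b - m..<b}" by blast+
    then have s: "s = ?v" "s + 2 * k \<le> b" using k(1,2) m by auto
    have "f x = f (x + k)" if "x \<in> insert ?v {b - m..<b} - {b - (Suc m - k)..<b}" for x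
      using r[of "x - s"] that s m by (auto simp: algebra_simps)
    then show "\<exists>k\<in>K. \<forall>x\<in>insert ?v {b - m..<b} - {b - (Suc m - k)..<b}. f x = f (x + k)"
      using s k(1) by (intro bexI[of _ k]) (auto simp: K_def)
  qed (use m assms deg in \<open>auto simp: K_def finite_L card_L sym_E irrefl_E\<close>)
  also have "(\<Sum>k\<in>K. card (good_colourings L E {b - (Suc m - k)..<b})) \<le>
      (\<Sum>k=2..Suc m. card (good_colourings L E {b - (Suc m - k)..<b}))"
    by (rule sum_mono2) (use K in auto)
  finally show "4 * count (b - m) b \<le> count (b - Suc m) b + (\<Sum>k=2..Suc m. count (b - (Suc m - k)) b)"
    unfolding ins by (simp flip: of_nat_sum)
qed (use assms in auto)

lemma count_interval_le:
  assumes "a \<le> b" "b \<le> N"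
  shows "3 ^ (N - (b - a)) * count a b \<le> count 0 N"
proof -
  have right: "3 ^ j * count a b \<le> count a (b + j)" if "b + j \<le> N" for j
    using that
  proof (induction j)
    case (Suc j)
    then show ?case using count_extend_right[of a "b + j - a"] assms(1) by simp
  qed simp
  have left: "3 ^ j * count a N \<le> count (a - j) N" if "j \<le> a" for j
    using that
  proof (induction j)
    case (Suc j)
    then have "N - (a - j) < N" "N - (N - (a - j)) = a - j" "N - Suc (N - (a - j)) = a - Suc j"
      using assms by auto
    then show ?case using count_extend_left[of "N - (a - j)" N] Suc by simp
  qed simp
  have "N - (b - a) = a + (N - b)" using assms by simp
  then have "3 ^ (N - (b - a)) * count a b = 3 ^ a * (3 ^ (N - b) * count a b)"
    by (simp add: power_add)
  also have "\<dots> \<le> 3 ^ a * count a N" using right[of "N - b"] assms(2) by simp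
  also have "\<dots> \<le> count 0 N" using left[of a] by simp
  finally show ?thesis .
qed

text \<open>The half to delete is the one at the seam between \<open>N - 1\<close> and 0: the second
  if \<open>s + k \<le> N\<close>, otherwise the first. What remains is a genuine interval of
  \<open>N - k\<close> positions containing the other half, so it determines the colouring, and
  \<open>count_interval_le\<close> supplies the factor \<open>3 ^ k\<close>.\<close>

lemma count_wrapped:
  assumes k: "1 \<le> k" "2 * k \<le> N" and s: "s < N" "N < s + 2 * k"
  defines "B \<equiv> {f \<in> good_colourings L E {0..<N}. \<forall>i<k. f ((s + i) mod N) = f ((s + k + i) mod N)}"
  shows "3 ^ k * real (card B) \<le> count 0 N"
proof -
  have fin: "finite (good_colourings L E {a..<b})" if "b \<le> N" for a b
    by (rule finite_good_colourings) (use that finite_L in auto)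
  have "\<exists>a b. a \<le> b \<and> b \<le> N \<and> N - (b - a) = k \<and> card B \<le> card (good_colourings L E {a..<b})"
  proof (cases "s + k \<le> N")
    case True
    have "card B \<le> card (good_colourings L E {s + 2 * k - N..<s + k})"
    \<comment> \<open>A cyclic shift back by \<open>k\<close>; adding \<open>N\<close> first
      prevents truncated subtraction.\<close>
    proof (rule card_determined_le[where T = "{0..<N}" and \<sigma> = "\<lambda>x. (x + N - k) mod N"])
      fix x assume x: "x \<in> {0..<N} - {s + 2 * k - N..<s + k}"
      show "(x + N - k) mod N \<in> {s + 2 * k - N..<s + k}"
      proof (cases "x < k")
        case True
        then show ?thesis using x k s \<open>s + k \<le> N\<close> by auto
      next
        case False
        then have "x + N - k = (x - k) + N" "x - k < N" using x by auto
        then have "(x + N - k) mod N = x - k" by (metis mod_add_self2 mod_less)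
        moreover have "s + k \<le> x" using x k s \<open>s + k \<le> N\<close> False by auto
        then have "s + 2 * k - N \<le> x - k" "x - k < s + k" using x k s by auto
        ultimately show ?thesis by simp
      qed
      fix f assume f: "f \<in> B"
      have eq: "f ((s + i) mod N) = f ((s + k + i) mod N)" if "i < k" for i
        using f that by (simp add: B_def)
      show "f x = f ((x + N - k) mod N)"
      proof (cases "x < s + k")
        case True
        \<comment> \<open>Being outside the kept interval but below \<open>s + k\<close>, the
          position \<open>x\<close> lies after the seam, so its index in the second half is
          \<open>x + N - s - k\<close>.\<close>
        then have "f ((s + (x + N - s - k)) mod N) = f ((s + k + (x + N - s - k)) mod N)"
          by (intro eq) (use x s k in auto)
        moreover have "s + (x + N - s - k) = x + N - k" "s + k + (x + N - s - k) = x + N"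
          using s \<open>s + k \<le> N\<close> by auto
        ultimately show ?thesis using x by simp
      next
        case False
        then have "f ((s + (x - s - k)) mod N) = f ((s + k + (x - s - k)) mod N)"
          by (intro eq) (use x s k in auto)
        moreover have "s + (x - s - k) = x - k" "s + k + (x - s - k) = x"
          using False by auto
        moreover have "x + N - k = (x - k) + N" "x - k < N" using x False by auto
        then have "(x + N - k) mod N = x - k" by (metis mod_add_self2 mod_less)
        ultimately show ?thesis using x by simp
      qed
    qed (use k s True in \<open>auto simp: B_def good_colourings_def[of _ _ "{0..<N}"] intro!: fin\<close>,
         auto intro!: restrict_good_colourings[where S = "{0..<N}"] simp: good_colourings_def[of _ _ "{0..<N}"])
    then show ?thesis using True k s by (intro exI[of _ "s + 2 * k - N"] exI[of _ "s + k"]) auto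
  next
    case False
    note sk = False
    have "card B \<le> card (good_colourings L E {s + k - N..<s})"
    proof (rule card_determined_le[where T = "{0..<N}" and \<sigma> = "\<lambda>x. (x + k) mod N"])
      fix x assume x: "x \<in> {0..<N} - {s + k - N..<s}"
      show "(x + k) mod N \<in> {s + k - N..<s}"
        using x k s False by (auto simp: mod_if)
      fix f assume f: "f \<in> B"
      have eq: "f ((s + i) mod N) = f ((s + k + i) mod N)" if "i < k" for i
        using f that by (simp add: B_def)
      show "f x = f ((x + k) mod N)"
      proof (cases "x < s")
        case True
        then have "f ((s + (x + N - s)) mod N) = f ((s + k + (x + N - s)) mod N)"
          by (intro eq) (use x s k sk in auto)
        moreover have "s + (x + N - s) = x + N" "s + k + (x + N - s) = x + k + N"
          using s by auto
        ultimately show ?thesis using x by simp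
      next
        case False
        then have "f ((s + (x - s)) mod N) = f ((s + k + (x - s)) mod N)"
          by (intro eq) (use x s k sk in auto)
        then show ?thesis using x False by (simp add: algebra_simps)
      qed
    qed (use k s False in \<open>auto simp: B_def good_colourings_def[of _ _ "{0..<N}"] intro!: fin\<close>,
         auto intro!: restrict_good_colourings[where S = "{0..<N}"] simp: good_colourings_def[of _ _ "{0..<N}"])
    then show ?thesis using False k s by (intro exI[of _ "s + k - N"] exI[of _ s]) auto
  qed
  then obtain a b where ab: "a \<le> b" "b \<le> N" "N - (b - a) = k" "card B \<le> card (good_colourings L E {a..<b})"
    by blast
  have "3 ^ k * real (card B) \<le> 3 ^ k * count a b" using ab(4) by simp
  also have "\<dots> \<le> count 0 N" using count_interval_le[OF ab(1,2)] ab(3) by simp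
  finally show ?thesis .
qed

theorem exists_cyclic_colouring:
  "\<exists>f. (\<forall>p<N. f p \<in> L p) \<and> (\<forall>p<N. \<forall>q<N. E p q \<longrightarrow> f p \<noteq> f q) \<and>
     (\<forall>s<N. \<forall>k\<ge>2. 2 * k \<le> N \<longrightarrow> (\<exists>i<k. f ((s + i) mod N) \<noteq> f ((s + k + i) mod N)))"
proof -
  let ?G = "good_colourings L E {0..<N}"
  define B where "B s k = {f \<in> ?G. \<forall>i<k. f ((s + i) mod N) = f ((s + k + i) mod N)}" for s k
  define K where "K = {2..N div 2}"
  \<comment> \<open>The starting positions from which a run of length \<open>2 * k\<close> passes
    the seam, \<open>2 * k - 1\<close> in number.\<close>
  define J where "J k = {N - 2 * k + 1..<N}" for k
  have fin: "finite ?G" by (rule finite_good_colourings) (use finite_L in auto)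
  have pos: "0 < count 0 N"
  proof -
    \<comment> \<open>The empty interval has exactly one colouring; growth from it makes the total
      count positive, as the strict comparison below requires.\<close>
    have "good_colourings L E {0..<0} = {\<lambda>_. undefined}" by (auto simp: good_colourings_def)
    then have "(0::real) < 3 ^ N * count 0 0" by simp
    also have "\<dots> \<le> count 0 N" using count_interval_le[of 0 0] by simp
    finally show ?thesis .
  qed
  have "real (card (\<Union>k\<in>K. \<Union>s\<in>J k. B s k)) \<le> (\<Sum>k\<in>K. \<Sum>s\<in>J k. real (card (B s k)))"
  proof -
    have "card (\<Union>k\<in>K. \<Union>s\<in>J k. B s k) \<le> (\<Sum>k\<in>K. card (\<Union>s\<in>J k. B s k))"
      by (rule card_UN_le) (simp add: K_def)
    also have "\<dots> \<le> (\<Sum>k\<in>K. \<Sum>s\<in>J k. card (B s k))"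
      by (intro sum_mono card_UN_le) (simp add: J_def)
    finally show ?thesis by (simp flip: of_nat_sum)
  qed
  also have "\<dots> \<le> (\<Sum>k\<in>K. \<Sum>s\<in>J k. count 0 N * (1 / 3) ^ k)"
  proof (intro sum_mono)
    fix k s assume "k \<in> K" "s \<in> J k"
    then have "3 ^ k * real (card (B s k)) \<le> count 0 N"
      unfolding B_def K_def J_def by (intro count_wrapped) auto
    then show "real (card (B s k)) \<le> count 0 N * (1 / 3) ^ k"
      by (simp add: power_one_over field_simps)
  qed
  also have "\<dots> = count 0 N * (\<Sum>k\<in>K. real (2 * k - 1) * (1 / 3) ^ k)"
  proof -
    have "card (J k) = 2 * k - 1" if "k \<in> K" for k using that by (auto simp: J_def K_def)
    then show ?thesis by (simp add: sum_distrib_left algebra_simps)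
  qed
  also have "\<dots> < count 0 N * 1"
  proof (rule mult_strict_left_mono[OF _ pos])
    show "(\<Sum>k\<in>K. real (2 * k - 1) * (1 / 3) ^ k) < (1 :: real)"
    proof (cases "1 \<le> N div 2")
      case True
      have "0 \<le> real (N div 2 + 1) * (1 / 3) ^ (N div 2)" by simp
      then show ?thesis unfolding K_def sum_odd_thirds[OF True] by linarith
    qed (simp add: K_def)
  qed
  finally have lt: "card (\<Union>k\<in>K. \<Union>s\<in>J k. B s k) < card ?G" by simp
  have "finite (\<Union>k\<in>K. \<Union>s\<in>J k. B s k)"
    by (rule finite_subset[OF _ fin]) (auto simp: B_def)
  then have "\<not> ?G \<subseteq> (\<Union>k\<in>K. \<Union>s\<in>J k. B s k)" using card_mono[of "\<Union>k\<in>K. \<Union>s\<in>J k. B s k" ?G] lt by linarith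
  then obtain f where f: "f \<in> ?G" "f \<notin> (\<Union>k\<in>K. \<Union>s\<in>J k. B s k)" by blast
  have "\<exists>i<k. f ((s + i) mod N) \<noteq> f ((s + k + i) mod N)" if "s < N" "2 \<le> k" "2 * k \<le> N" for s k
  proof (cases "s + 2 * k \<le> N")
    case True
    then have "{s..<s + 2 * k} \<subseteq> {0..<N}" by auto
    then obtain i where "i < k" "f (s + i) \<noteq> f (s + k + i)"
      using f(1) \<open>2 \<le> k\<close> unfolding good_colourings_def by blast
    then show ?thesis using True by (intro exI[of _ i]) auto
  next
    case False
    then have "k \<in> K" "s \<in> J k" using that by (auto simp: K_def J_def)
    then show ?thesis using f by (auto simp: B_def)
  qed
  moreover have "\<forall>p<N. f p \<in> L p" "\<forall>p<N. \<forall>q<N. E p q \<longrightarrow> f p \<noteq> f q"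
    using f(1) unfolding good_colourings_def PiE_iff by simp_all
  ultimately show ?thesis by blast
qed

end

section \<open>Corners in the integer lattice\<close>

text \<open>Integer coordinates, since differences of vertices are treated as directions and may be
  negative.\<close>

definition lat :: "int \<Rightarrow> int \<Rightarrow> complex" where
  "lat i j = Complex (of_int i) (of_int j)"

lemma lat_eq_iff [simp]: "lat i j = lat i' j' \<longleftrightarrow> i = i' \<and> j = j'"
  by (simp add: lat_def)

lemma lat_add: "lat i j + lat i' j' = lat (i + i') (j + j')"
  by (simp add: lat_def complex_eq_iff)

lemma pt_eq_lat: "pt i j = lat (int i) (int j)"
  by (simp add: pt_def lat_def)

text \<open>
  The directions \<open>(a, b)\<close> with \<open>a, b \<in> {-1, 0, 1}\<close>, numbered counterclockwise in multiples of
  \<open>\<pi>/4\<close>; the value at \<open>(0, 0)\<close> is junk.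
\<close>

definition dir_index :: "int \<Rightarrow> int \<Rightarrow> nat" where
  "dir_index a b =
     (if a = 1 then if b = 1 then 1 else if b = 0 then 0 else 7
      else if a = 0 then if b = 1 then 2 else 6
      else if b = 1 then 3 else if b = 0 then 4 else 5)"

text \<open>The moves of a chess king: every edge of an apic graph is one, so eight directions
  suffice.\<close>

definition king_step :: "int \<Rightarrow> int \<Rightarrow> bool" where
  "king_step a b \<longleftrightarrow> \<bar>a\<bar> \<le> 1 \<and> \<bar>b\<bar> \<le> 1 \<and> (a, b) \<noteq> (0, 0)"

lemma dir_index_less: "dir_index a b < 8"
  by (simp add: dir_index_def)

lemma norm_lat_ge_1:
  assumes "king_step a b"
  shows "1 \<le> norm (lat a b)"
proof -
  have "0 < a\<^sup>2 + b\<^sup>2" using assms by (auto simp: king_step_def sum_power2_gt_zero_iff)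
  then have "1 \<le> real_of_int (a\<^sup>2 + b\<^sup>2)" by linarith
  then show ?thesis by (simp add: lat_def cmod_def)
qed

text \<open>Powers of the primitive eighth root of unity \<open>cis (pi / 4)\<close> give the eight
  directions; this justifies \<open>dir_index\<close> as an argument in units of
  \<open>pi / 4\<close>.\<close>

lemma lat_polar:
  assumes "king_step a b"
  shows "lat a b = norm (lat a b) * cis (pi / 4 * dir_index a b)"
proof -
  let ?w = "cis (pi / 4)"
  have pow: "cis (pi / 4 * dir_index a b) = ?w ^ dir_index a b"
    unfolding Complex.DeMoivre by (rule arg_cong[where f = cis]) simp
  have w: "complex_of_real (sqrt 2) * ?w = lat 1 1"
    by (simp add: complex_eq_iff cos_45 sin_45 lat_def)
  have w2: "?w ^ 2 = \<i>" by (simp add: Complex.DeMoivre)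
  have w3: "?w ^ 3 = \<i> * ?w" "?w ^ 4 = -1" "?w ^ 5 = - ?w" "?w ^ 6 = - \<i>" "?w ^ 7 = - (\<i> * ?w)"
    using w2 by (simp_all add: power_numeral_reduce power2_eq_square algebra_simps)
  consider "a = 1" "b = 0" | "a = 1" "b = 1" | "a = 0" "b = 1" | "a = -1" "b = 1"
    | "a = -1" "b = 0" | "a = -1" "b = -1" | "a = 0" "b = -1" | "a = 1" "b = -1"
    using assms by (auto simp: king_step_def abs_le_iff) linarith+
  then show ?thesis unfolding pow
    by cases (auto simp: dir_index_def lat_def cmod_def complex_eq_iff w2 w3 cos_45 sin_45)
qed

text \<open>The summand 8 keeps the subtraction of naturals from truncating, and reduction modulo 8
  is harmless because \<open>cis (pi / 4)\<close> has eighth power 1.\<close>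

lemma cis_index_diff:
  fixes a b :: nat
  assumes "a < 8" "b < 8"
  shows "cis (pi / 4 * ((b + 8 - a) mod 8)) * cis (pi / 4 * a) = cis (pi / 4 * b)"
proof -
  let ?m = "(b + 8 - a) mod 8"
  have "?m + a = b \<or> ?m + a = b + 8"
  proof (cases "a \<le> b")
    case True
    then have "b + 8 - a = (b - a) + 8" by simp
    then have "?m = (b - a) mod 8" by (metis mod_add_self2)
    then show ?thesis using True assms by simp
  next
    case False
    then show ?thesis using assms by simp
  qed
  then have "cis (pi / 4) ^ (?m + a) = cis (pi / 4) ^ b"
  proof
    assume "?m + a = b + 8"
    moreover have "cis (pi / 4) ^ 8 = 1" by (simp add: Complex.DeMoivre)
    ultimately show ?thesis by (metis power_add mult.right_neutral)
  qed (rule arg_cong)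
  then have "cis (real ?m * (pi / 4)) * cis (real a * (pi / 4)) = cis (real b * (pi / 4))"
    unfolding power_add Complex.DeMoivre .
  then show ?thesis by (simp only: mult.commute)
qed

text \<open>The condition \<open>0 < l\<close> excludes equal directions, for which
  \<open>ccw_angle\<close> is the full angle instead of 0.\<close>

lemma ccw_angle_lat:
  assumes "king_step a1 a2" "king_step b1 b2"
  defines "l \<equiv> (dir_index b1 b2 + 8 - dir_index a1 a2) mod 8"
  assumes "0 < l"
  shows "ccw_angle (lat a1 a2) (lat b1 b2) = pi / 4 * l"
proof -
  let ?A = "dir_index a1 a2" and ?B = "dir_index b1 b2"
  have l: "l < 8" by (simp add: l_def)
  have na: "0 < norm (lat a1 a2)" "0 < norm (lat b1 b2)"
    using norm_lat_ge_1[OF assms(1)] norm_lat_ge_1[OF assms(2)] by auto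
  have cis: "cis (pi / 4 * ?B) = cis (pi / 4 * l) * cis (pi / 4 * ?A)"
    unfolding l_def by (rule cis_index_diff[symmetric]) (simp_all add: dir_index_less)
  have "Arg2pi (lat b1 b2 / lat a1 a2) = pi / 4 * l"
  proof (rule Arg2pi_unique)
    show "0 < norm (lat b1 b2) / norm (lat a1 a2)" using na by simp
    have "lat b1 b2 / lat a1 a2 = norm (lat b1 b2) * cis (pi / 4 * ?B) / (norm (lat a1 a2) * cis (pi / 4 * ?A))"
      using lat_polar assms(1,2) by metis
    also have "\<dots> = of_real (norm (lat b1 b2) / norm (lat a1 a2)) * exp (\<i> * of_real (pi / 4 * l))"
      unfolding cis using na by (simp add: cis_conv_exp divide_simps)
    finally show "of_real (norm (lat b1 b2) / norm (lat a1 a2)) * exp (\<i> * of_real (pi / 4 * l)) =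
        lat b1 b2 / lat a1 a2" by simp
    have "real l < 8" using l by simp
    then show "pi / 4 * real l < 2 * pi" by simp
  qed simp
  moreover have "pi / 4 * real l \<noteq> 0" using assms(4) by simp
  ultimately show ?thesis unfolding ccw_angle_def by presburger
qed

text \<open>The open sector swept counterclockwise from direction \<open>a\<close> to direction
  \<open>b\<close>, in arithmetic that simplification can decide. For equal directions it is empty,
  unlike the sector of \<open>ccw_angle\<close>; \<open>turn\<close> rules that case out.\<close>

definition strictly_between :: "int \<Rightarrow> int \<Rightarrow> int \<Rightarrow> int \<Rightarrow> int \<Rightarrow> int \<Rightarrow> bool" where
  "strictly_between a1 a2 c1 c2 b1 b2 \<longleftrightarrow>
     (let m = (dir_index c1 c2 + 8 - dir_index a1 a2) mod 8;
          l = (dir_index b1 b2 + 8 - dir_index a1 a2) mod 8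
      in 0 < m \<and> m < l)"

text \<open>If the edge towards \<open>c\<close> entered the sector, a point of it close to
  \<open>v\<close> would lie in \<open>F\<close> by the corner condition, although \<open>F\<close>
  misses that edge.\<close>

lemma left_corner_sector_free:
  assumes k: "king_step a1 a2" "king_step b1 b2" "king_step c1 c2"
    and corner: "left_corner F (v + lat b1 b2) v (v + lat a1 a2)"
    and free: "F \<inter> convex hull {v, v + lat c1 c2} = {}"
  shows "\<not> strictly_between a1 a2 c1 c2 b1 b2"
proof
  let ?A = "dir_index a1 a2" and ?B = "dir_index b1 b2" and ?C = "dir_index c1 c2"
  define m where "m = (?C + 8 - ?A) mod 8"
  define l where "l = (?B + 8 - ?A) mod 8"
  assume "strictly_between a1 a2 c1 c2 b1 b2"
  then have ml: "0 < m" "m < l" unfolding strictly_between_def m_def l_def Let_def by auto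
  have cis: "cis (pi / 4 * m) * cis (pi / 4 * ?A) = cis (pi / 4 * ?C)"
    unfolding m_def by (rule cis_index_diff) (simp_all add: dir_index_less)
  have na: "0 < norm (lat a1 a2)" "1 \<le> norm (lat c1 c2)"
    using norm_lat_ge_1[OF k(1)] norm_lat_ge_1[OF k(3)] by auto
  have sgn: "sgn (lat a1 a2) = cis (pi / 4 * ?A)"
    by (subst lat_polar[OF k(1)]) (use na(1) in \<open>simp add: sgn_mult sgn_of_real sgn_eq norm_mult\<close>)
  have angle: "ccw_angle (lat a1 a2) (lat b1 b2) = pi / 4 * l"
    unfolding l_def using ml by (intro ccw_angle_lat k) (simp add: l_def)
  obtain \<epsilon> where \<epsilon>: "\<epsilon> > 0"
    "\<And>r t. 0 < r \<Longrightarrow> r < \<epsilon> \<Longrightarrow> 0 < t \<Longrightarrow> t < pi / 4 * l \<Longrightarrow> v + complex_of_real r * cis t * cis (pi / 4 * ?A) \<in> F"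
    using corner unfolding left_corner_def by (auto simp: angle sgn)
  \<comment> \<open>Below \<open>\<epsilon>\<close> for the corner condition, and at most 1, hence
    no longer than the edge.\<close>
  define r where "r = min (\<epsilon> / 2) 1"
  have r: "0 < r" "r < \<epsilon>" "r \<le> 1" using \<epsilon>(1) by (auto simp: r_def)
  have "pi / 4 * m < pi / 4 * l" using ml by simp
  then have "v + complex_of_real r * cis (pi / 4 * m) * cis (pi / 4 * ?A) \<in> F"
    using \<epsilon>(2)[OF r(1,2), of "pi / 4 * m"] ml by simp
  then have inF: "v + complex_of_real r * cis (pi / 4 * ?C) \<in> F"
    using cis by (simp add: mult.assoc)
  define q where "q = r / norm (lat c1 c2)"
  have q: "0 \<le> q" "q \<le> 1" using r na by (auto simp: q_def divide_simps)
  have "complex_of_real r * cis (pi / 4 * ?C) = q *\<^sub>R (norm (lat c1 c2) * cis (pi / 4 * ?C))"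
    using na(2) by (auto simp: q_def scaleR_conv_of_real)
  also have "\<dots> = q *\<^sub>R lat c1 c2" using lat_polar[OF k(3)] by simp
  finally have "v + complex_of_real r * cis (pi / 4 * ?C) = (1 - q) *\<^sub>R v + q *\<^sub>R (v + lat c1 c2)"
    by (simp add: algebra_simps)
  then have "v + complex_of_real r * cis (pi / 4 * ?C) \<in> convex hull {v, v + lat c1 c2}"
    using q unfolding segment_convex_hull[symmetric] in_segment by blast
  then show False using inF free by blast
qed

section \<open>Turns in the triangulated ladder\<close>

locale ladder_with_diagonals =
  fixes n :: nat and t :: "int \<Rightarrow> bool"
  assumes n: "2 \<le> n"
begin

text \<open>\<open>t i\<close> says that the diagonal between the columns \<open>i\<close> and \<open>i + 1\<close> goes up to the right.\<close>

definition adj :: "int \<Rightarrow> int \<Rightarrow> int \<Rightarrow> int \<Rightarrow> bool" where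
  "adj i j i' j' \<longleftrightarrow> 0 \<le> i \<and> i < int n \<and> 0 \<le> j \<and> j \<le> 1 \<and> 0 \<le> i' \<and> i' < int n \<and> 0 \<le> j' \<and> j' \<le> 1 \<and>
     (i = i' \<and> j \<noteq> j' \<or> \<bar>i - i'\<bar> = 1 \<and> (j = j' \<or> (t (min i i') \<longleftrightarrow> i' - i = j' - j)))"

text \<open>The combinatorial content of a corner: no edge leaves \<open>(i, j)\<close> into the left sector.\<close>

definition turn :: "int \<Rightarrow> int \<Rightarrow> int \<Rightarrow> int \<Rightarrow> int \<Rightarrow> int \<Rightarrow> bool" where
  "turn i1 j1 i j i2 j2 \<longleftrightarrow> adj i j i1 j1 \<and> adj i j i2 j2 \<and> (i1, j1) \<noteq> (i2, j2) \<and>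
     (\<forall>i' j'. adj i j i' j' \<longrightarrow> \<not> strictly_between (i2 - i) (j2 - j) (i' - i) (j' - j) (i1 - i) (j1 - j))"

text \<open>The darts with the outer face on the left, so clockwise around the ladder.\<close>

definition outer_dart :: "int \<Rightarrow> int \<Rightarrow> int \<Rightarrow> int \<Rightarrow> bool" where
  "outer_dart i j i' j' \<longleftrightarrow>
     j = 1 \<and> j' = 1 \<and> i' = i + 1 \<and> 0 \<le> i \<and> i' < int n \<or>
     j = 0 \<and> j' = 0 \<and> i' = i - 1 \<and> 0 \<le> i' \<and> i < int n \<or>
     i = 0 \<and> i' = 0 \<and> j = 0 \<and> j' = 1 \<or>
     i = int n - 1 \<and> i' = i \<and> j = 1 \<and> j' = 0"

text \<open>The determinant is twice the signed area; its value 1 encodes counterclockwise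
  orientation.\<close>

definition ccw_triangle :: "int \<Rightarrow> int \<Rightarrow> int \<Rightarrow> int \<Rightarrow> int \<Rightarrow> int \<Rightarrow> bool" where
  "ccw_triangle i1 j1 i2 j2 i3 j3 \<longleftrightarrow> adj i1 j1 i2 j2 \<and> adj i2 j2 i3 j3 \<and> adj i3 j3 i1 j1 \<and>
     (i2 - i1) * (j3 - j1) - (j2 - j1) * (i3 - i1) = 1"

lemma adj_cases:
  assumes "adj i j i' j'"
  obtains (rung) "i' = i" "j' = 1 - j" | (right) "i' = i + 1" "j' = j" | (left) "i' = i - 1" "j' = j"
    | (dright) "i' = i + 1" "j' = 1 - j" "t i \<longleftrightarrow> j = 0" | (dleft) "i' = i - 1" "j' = 1 - j" "t (i - 1) \<longleftrightarrow> j = 1"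
proof -
  have "j = 0 \<or> j = 1" "j' = 0 \<or> j' = 1" using assms by (auto simp: adj_def)
  moreover have "i' = i \<or> i' = i + 1 \<or> i' = i - 1" using assms by (auto simp: adj_def)
  ultimately show ?thesis using assms that unfolding adj_def by (elim disjE) (auto simp: min_def)
qed

lemma turn_free:
  assumes "turn i1 j1 i j i2 j2" "adj i j i' j'"
  shows "\<not> strictly_between (i2 - i) (j2 - j) (i' - i) (j' - j) (i1 - i) (j1 - j)"
  using assms unfolding turn_def by blast

lemma turn_facts:
  assumes "turn i1 j1 i j i2 j2"
  shows "adj i j i1 j1" "adj i j i2 j2" "(i1, j1) \<noteq> (i2, j2)"
  using assms unfolding turn_def by blast+

text \<open>With the left sector free, the next vertex is the first neighbour clockwise after the
  previous one. Off the outer face this is the apex of the triangle to the left of the dart. The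
  case check tests all five kinds of neighbours.\<close>

lemma turn_inner:
  assumes T: "turn i1 j1 i j i2 j2" and O: "\<not> outer_dart i1 j1 i j"
  shows "ccw_triangle i1 j1 i j i2 j2"
proof -
  note A = turn_facts[OF T]
  have j: "j = 0 \<or> j = 1" using A(1) by (auto simp: adj_def)
  note F = turn_free[OF T, of i "1 - j"] turn_free[OF T, of "i + 1" j] turn_free[OF T, of "i - 1" j]
    turn_free[OF T, of "i + 1" "1 - j"] turn_free[OF T, of "i - 1" "1 - j"]
  show ?thesis
    using A(1)
    by (cases rule: adj_cases; use A(2) in \<open>cases rule: adj_cases\<close>; use j in \<open>elim disjE\<close>;
      use A(3) O F A(1,2) in \<open>auto simp: adj_def outer_dart_def ccw_triangle_def strictly_between_def dir_index_def min_def\<close>)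
qed

text \<open>No edge lies inside the triangle, so a turn elsewhere would have the closing edge in its
  left sector. Hence a walk that starts around a triangle repeats its first vertex after three
  steps.\<close>

lemma turn_triangle:
  assumes C: "ccw_triangle i1 j1 i2 j2 i3 j3" and T: "turn i2 j2 i3 j3 i4 j4"
  shows "i4 = i1 \<and> j4 = j1"
proof -
  note A = turn_facts[OF T]
  have B: "adj i3 j3 i1 j1" using C by (simp add: ccw_triangle_def)
  have j: "j3 = 0 \<or> j3 = 1" using A(1) by (auto simp: adj_def)
  note F = turn_free[OF T B]
  show ?thesis
    using A(1)
    by (cases rule: adj_cases; use A(2) in \<open>cases rule: adj_cases\<close>; use B in \<open>cases rule: adj_cases\<close>; use j in \<open>elim disjE\<close>;
      use A(3) F A(1,2) B C in \<open>simp add: adj_def ccw_triangle_def strictly_between_def dir_index_def min_def\<close>)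
qed

text \<open>Neighbours on the outer cycle lie along the row or the rung, so these three directions
  are the only obstacles tested.\<close>

lemma turn_outer:
  assumes T: "turn i1 j1 i j i2 j2" and O: "outer_dart i1 j1 i j"
  shows "outer_dart i j i2 j2"
proof -
  note A = turn_facts[OF T]
  have j: "j = 0 \<or> j = 1" using A(1) by (auto simp: adj_def)
  have R: "i = 0 \<or> 0 < i" "i = int n - 1 \<or> i + 1 < int n" using A(1) by (auto simp: adj_def)
  note F = turn_free[OF T, of i "1 - j"] turn_free[OF T, of "i + 1" j] turn_free[OF T, of "i - 1" j]
  show ?thesis
    using A(2)
    by (cases rule: adj_cases; use A(1) in \<open>cases rule: adj_cases\<close>; use j in \<open>elim disjE\<close>;
      use A(3) O F A(1,2) R n in
        \<open>auto simp: adj_def outer_dart_def strictly_between_def dir_index_def min_def\<close>)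
qed

end

section \<open>Boundary walks of apic graphs\<close>

context ladder_with_diagonals
begin

lemma adj_sym: "adj i j i' j' \<Longrightarrow> adj i' j' i j"
  by (auto simp: adj_def min.commute)

lemma king_step_adj: "adj i j i' j' \<Longrightarrow> king_step (i' - i) (j' - j)"
  by (auto simp: adj_def king_step_def)

text \<open>The vertices in the order of the outer cycle: the top row rightwards, then the bottom row back.\<close>

definition cyc :: "nat \<Rightarrow> complex" where
  "cyc p = (if p < n then lat (int p) 1 else lat (2 * int n - 1 - int p) 0)"

lemma inj_on_cyc: "inj_on cyc {..<2 * n}"
  by (auto simp: inj_on_def cyc_def split: if_splits)

lemma cyc_surj:
  assumes "0 \<le> i" "i < int n" "0 \<le> j" "j \<le> 1"
  shows "\<exists>p<2 * n. lat i j = cyc p"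
proof (cases "j = 1")
  case True
  then show ?thesis using assms by (intro exI[of _ "nat i"]) (auto simp: cyc_def nat_less_iff)
next
  case False
  then show ?thesis using assms
    by (intro exI[of _ "2 * n - 1 - nat i"]) (auto simp: cyc_def nat_less_iff of_nat_diff)
qed

lemma outer_dart_cyc:
  assumes "outer_dart i j i' j'" "p < 2 * n" "lat i j = cyc p"
  shows "lat i' j' = cyc (Suc p mod (2 * n))"
proof (cases "Suc p < 2 * n")
  case True
  then show ?thesis using assms n by (auto simp: outer_dart_def cyc_def split: if_splits)
next
  case False
  then have "Suc p = 2 * n" using assms(2) by simp
  then show ?thesis using assms n by (auto simp: outer_dart_def cyc_def split: if_splits)
qed

end

section \<open>From the plane drawing to the combinatorial model\<close>

locale apic =
  fixes n :: nat and A :: geom_graph and d :: "nat \<Rightarrow> complex set"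
  assumes n2: "2 \<le> n"
    and d: "\<And>i. i + 1 < n \<Longrightarrow> d i \<in> diagonals i"
    and A: "A = \<lparr> verts = verts (ladder n), edges = edges (ladder n) \<union> d ` {i. i + 1 < n} \<rparr>"
    and deg: "\<And>v. v \<in> verts A \<Longrightarrow> degree A v \<le> 4"
    and fin: "finite (edges A)"
begin

definition t :: "int \<Rightarrow> bool" where
  "t i \<longleftrightarrow> d (nat i) = {pt (nat i) 0, pt (nat i + 1) 1}"

sublocale ladder_with_diagonals n t
  by unfold_locales (rule n2)

lemma verts_A: "verts A = cyc ` {..<2 * n}"
proof
  show "verts A \<subseteq> cyc ` {..<2 * n}"
  proof
    fix v assume "v \<in> verts A"
    then obtain i j where "v = lat (int i) (int j)" "i < n" "j < 2"
      by (auto simp: A ladder_def pt_eq_lat)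
    then show "v \<in> cyc ` {..<2 * n}" using cyc_surj[of "int i" "int j"] by auto
  qed
  show "cyc ` {..<2 * n} \<subseteq> verts A"
  proof clarify
    fix p assume p: "p < 2 * n"
    show "cyc p \<in> verts A"
    proof (cases "p < n")
      case True
      then have "cyc p = pt p 1" by (simp add: cyc_def pt_eq_lat)
      then have "\<exists>i j. cyc p = pt i j \<and> i < n \<and> j < 2"
        using True by (intro exI[of _ p] exI[of _ 1]) simp
      then show ?thesis by (simp add: A ladder_def)
    next
      case False
      then have "cyc p = pt (2 * n - 1 - p) 0" using p by (simp add: cyc_def pt_eq_lat of_nat_diff)
      moreover have "2 * n - 1 - p < n" using False n2 by simp
      ultimately show ?thesis by (force simp: A ladder_def simp del: pt_eq_iff)
    qed
  qed
qed

lemma edge_iff: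
  "{u, v} \<in> edges A \<longleftrightarrow> (\<exists>i j i' j'. u = lat i j \<and> v = lat i' j' \<and> adj i j i' j')"
    (is "_ \<longleftrightarrow> ?E u v")
proof
  have sym: "?E u v \<Longrightarrow> ?E v u" for u v using adj_sym by blast
  assume "{u, v} \<in> edges A"
  then consider (rung) i where "i < n" "{u, v} = {pt i 0, pt i 1}"
    | (step) i j where "i + 1 < n" "j < 2" "{u, v} = {pt i j, pt (i + 1) j}"
    | (diag) i where "i + 1 < n" "{u, v} = d i"
    by (auto simp: A ladder_def)
  then show "?E u v"
  proof cases
    case rung
    then have "?E (pt i 0) (pt i 1)" by (auto simp: pt_eq_lat adj_def)
    then show ?thesis using rung(2) sym unfolding doubleton_eq_iff by blast
  next
    case step
    then have "?E (pt i j) (pt (i + 1) j)" by (auto simp: pt_eq_lat adj_def)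
    then show ?thesis using step(3) sym unfolding doubleton_eq_iff by blast
  next
    case diag
    show ?thesis
    proof (cases "t (int i)")
      case True
      then have "?E (pt i 0) (pt (i + 1) 1)" using diag by (auto simp: pt_eq_lat adj_def)
      moreover have "{u, v} = {pt i 0, pt (i + 1) 1}" using True diag by (simp add: t_def)
      ultimately show ?thesis using sym unfolding doubleton_eq_iff by blast
    next
      case False
      then have "?E (pt i 1) (pt (i + 1) 0)" using diag by (auto simp: pt_eq_lat adj_def)
      moreover have "{u, v} = {pt i 1, pt (i + 1) 0}"
        using False diag d[of i] by (auto simp: t_def diagonals_def)
      ultimately show ?thesis using sym unfolding doubleton_eq_iff by blast
    qed
  qed
next
  \<comment> \<open>Edges are unordered and \<open>adj\<close> is symmetric, so it is enough to
    treat pairs in lexicographic order.\<close>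
  have fwd: "{lat i j, lat i' j'} \<in> edges A" if a: "adj i j i' j'" "i < i' \<or> i = i' \<and> j < j'" for i j i' j'
  proof -
    obtain k where k: "i = int k" "k < n" using a by (auto simp: adj_def dest: zero_le_imp_eq_int)
    have j: "j = 0 \<or> j = 1" using a by (auto simp: adj_def)
    show ?thesis
      using a(1)
    proof (cases rule: adj_cases)
      case rung
      then have "{lat i j, lat i' j'} = {pt k 0, pt k 1}" using a(2) j k by (auto simp: pt_eq_lat)
      then show ?thesis using k by (auto simp: A ladder_def)
    next
      case right
      then have "{lat i j, lat i' j'} = {pt k (nat j), pt (k + 1) (nat j)}" "k + 1 < n" "nat j < 2"
        using a j k by (auto simp: pt_eq_lat adj_def)
      then show ?thesis unfolding A ladder_def by auto
    next
      case dright
      have kn: "k + 1 < n" using a dright k by (auto simp: adj_def)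
      have tk: "t i \<longleftrightarrow> d k = {pt k 0, pt (k + 1) 1}" using k by (simp add: t_def)
      have "d k = {lat i j, lat i' j'}"
        using j
      proof
        assume "j = 0"
        then show ?thesis using tk dright k by (simp add: pt_eq_lat add.commute)
      next
        assume "j = 1"
        then have "d k = {pt k 1, pt (k + 1) 0}" using tk dright d[OF kn] by (auto simp: diagonals_def)
        then show ?thesis using \<open>j = 1\<close> dright k by (simp add: pt_eq_lat add.commute)
      qed
      then show ?thesis using kn unfolding A by auto
    qed (use a in auto)
  qed
  assume "?E u v"
  then obtain i j i' j' where *: "u = lat i j" "v = lat i' j'" "adj i j i' j'" by blast
  consider "i < i' \<or> i = i' \<and> j < j'" | "i' < i \<or> i' = i \<and> j' < j"
    using *(3) by (force simp: adj_def)
  then show "{u, v} \<in> edges A"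
  proof cases
    case 1
    then show ?thesis using fwd * by blast
  next
    case 2
    then show ?thesis using fwd[OF adj_sym[OF *(3)]] * by (simp add: insert_commute)
  qed
qed

text \<open>The topological input is only that a face, being a component of the complement of the
  drawing, misses every edge at the middle vertex.\<close>

lemma corner_turn:
  assumes F: "F \<in> faces A" and e: "{lat i1 j1, lat i j} \<in> edges A" "{lat i j, lat i2 j2} \<in> edges A"
    and ne: "lat i1 j1 \<noteq> lat i2 j2" and corner: "left_corner F (lat i1 j1) (lat i j) (lat i2 j2)"
  shows "turn i1 j1 i j i2 j2"
proof -
  have adj: "adj i j i1 j1" "adj i j i2 j2" using e adj_sym by (auto simp: edge_iff)
  have "\<not> strictly_between (i2 - i) (j2 - j) (i' - i) (j' - j) (i1 - i) (j1 - j)"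
    if a: "adj i j i' j'" for i' j'
  proof (rule left_corner_sector_free)
    show "left_corner F (lat i j + lat (i1 - i) (j1 - j)) (lat i j) (lat i j + lat (i2 - i) (j2 - j))"
      using corner by (simp add: lat_add)
    have "{lat i j, lat i' j'} \<in> edges A" using a edge_iff by blast
    then have "convex hull {lat i j, lat i' j'} \<subseteq> drawing A" unfolding drawing_def by blast
    moreover have "F \<inter> drawing A = {}" using F in_components_subset unfolding faces_def by blast
    ultimately show "F \<inter> convex hull {lat i j, lat i j + lat (i' - i) (j' - j)} = {}"
      by (auto simp: lat_add)
  qed (use adj a king_step_adj in auto)
  then show ?thesis using adj ne unfolding turn_def by auto
qed

lemma walk_nth_edge:
  assumes "boundary_walk A F ws" "prefix xs (rotate k ws)" "Suc m < length xs"
  shows "{xs ! m, xs ! Suc m} \<in> edges A"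
    and "Suc (Suc m) < length xs \<Longrightarrow> left_corner F (xs ! m) (xs ! Suc m) (xs ! Suc (Suc m))"
proof -
  let ?l = "length ws"
  have nth: "xs ! i = ws ! ((k + i) mod ?l)" if "i < length xs" for i
  proof -
    have "i < ?l" using prefix_length_le[OF assms(2)] that by simp
    moreover have "xs ! i = rotate k ws ! i" using assms(2) that by (auto simp: prefix_def nth_append)
    ultimately show ?thesis by (simp add: nth_rotate)
  qed
  have "(k + m) mod ?l < ?l" using assms(1) by (simp add: boundary_walk_def)
  moreover have "((k + m) mod ?l + 1) mod ?l = (k + Suc m) mod ?l"
    "((k + m) mod ?l + 2) mod ?l = (k + Suc (Suc m)) mod ?l"
    by (simp_all add: mod_simps)
  ultimately have "{ws ! ((k + m) mod ?l), ws ! ((k + Suc m) mod ?l)} \<in> edges A"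
    "left_corner F (ws ! ((k + m) mod ?l)) (ws ! ((k + Suc m) mod ?l)) (ws ! ((k + Suc (Suc m)) mod ?l))"
    using assms(1) unfolding boundary_walk_def Let_def by metis+
  then show "{xs ! m, xs ! Suc m} \<in> edges A"
    "Suc (Suc m) < length xs \<Longrightarrow> left_corner F (xs ! m) (xs ! Suc m) (xs ! Suc (Suc m))"
    using nth assms(3) by auto
qed

text \<open>An inner first dart would force the fourth vertex to equal the first, against
  distinctness. So the first dart is outer, and \<open>turn_outer\<close> keeps the path on the
  outer cycle.\<close>

lemma long_path_on_outer_cycle:
  assumes F: "F \<in> faces A" and walk: "boundary_walk A F ws" "prefix xs (rotate k ws)"
    and xs: "distinct xs" "4 \<le> length xs"
  obtains s where "s < 2 * n" "\<And>m. m < length xs \<Longrightarrow> xs ! m = cyc ((s + m) mod (2 * n))"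
proof -
  note edge = walk_nth_edge(1)[OF walk] and corner = walk_nth_edge(2)[OF walk]
  have "\<exists>i j. xs ! m = lat i j \<and> 0 \<le> i \<and> i < int n \<and> 0 \<le> j \<and> j \<le> 1" if "m < length xs" for m
  proof -
    have "\<exists>w. {xs ! m, w} \<in> edges A"
    proof (cases "Suc m < length xs")
      case True
      then show ?thesis using edge by blast
    next
      case False
      then have "Suc (m - 1) = m" using that xs(2) by simp
      then show ?thesis using edge[of "m - 1"] that by (metis insert_commute)
    qed
    then show ?thesis unfolding edge_iff by (auto simp: adj_def)
  qed
  then obtain X Y where XY: "\<And>m. m < length xs \<Longrightarrow> xs ! m = lat (X m) (Y m) \<and>
      0 \<le> X m \<and> X m < int n \<and> 0 \<le> Y m \<and> Y m \<le> 1"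
    by metis
  have turn: "turn (X m) (Y m) (X (Suc m)) (Y (Suc m)) (X (Suc (Suc m))) (Y (Suc (Suc m)))"
    if "Suc (Suc m) < length xs" for m
  proof (rule corner_turn[OF F])
    have "xs ! m \<noteq> xs ! Suc (Suc m)" using that xs(1) by (simp add: nth_eq_iff_index_eq)
    then show "lat (X m) (Y m) \<noteq> lat (X (Suc (Suc m))) (Y (Suc (Suc m)))" using XY that by auto
  qed (use edge[of m] edge[of "Suc m"] corner[of m] XY that in auto)
  have start: "outer_dart (X 0) (Y 0) (X 1) (Y 1)"
  proof (rule ccontr)
    assume "\<not> ?thesis"
    then have "ccw_triangle (X 0) (Y 0) (X 1) (Y 1) (X 2) (Y 2)"
      using turn[of 0] xs(2) turn_inner by (simp add: numeral_2_eq_2)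
    then have "X 3 = X 0 \<and> Y 3 = Y 0"
      using turn[of 1] xs(2) turn_triangle by (simp add: numeral_2_eq_2 numeral_3_eq_3)
    then have "xs ! 3 = xs ! 0" using XY[of 3] XY[of 0] xs(2) by fastforce
    then show False using xs nth_eq_iff_index_eq[of xs 3 0] by force
  qed
  have outer: "outer_dart (X m) (Y m) (X (Suc m)) (Y (Suc m))" if "Suc m < length xs" for m
    using that
  proof (induction m)
    case (Suc m)
    then show ?case using turn_outer[OF turn] by simp
  qed (use start in simp)
  obtain s where s: "s < 2 * n" "xs ! 0 = cyc s" using cyc_surj XY[of 0] xs(2) by fastforce
  have "xs ! m = cyc ((s + m) mod (2 * n))" if "m < length xs" for m
    using that
  proof (induction m)
    case (Suc m)
    have "lat (X (Suc m)) (Y (Suc m)) = cyc (Suc ((s + m) mod (2 * n)) mod (2 * n))"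
      using Suc XY[of m] s by (intro outer_dart_cyc[OF outer]) auto
    then show ?case using XY[of "Suc m"] Suc.prems by (simp add: mod_simps)
  qed (use s in simp)
  then show ?thesis using s that by blast
qed

section \<open>Choosability from lists of size 8\<close>

lemma facial_choosable_8: "facial_choosable A 8"
  unfolding facial_choosable_def
proof (intro allI impI)
  fix L :: "complex \<Rightarrow> nat set"
  assume L: "\<forall>v\<in>verts A. L v \<subseteq> {1..} \<and> (finite (L v) \<longrightarrow> 8 \<le> card (L v))"
  \<comment> \<open>Lists may be infinite, whereas counting needs finite ones; each is cut down to
    eight colours.\<close>
  have "\<exists>M\<subseteq>L v. finite M \<and> card M = 8" if "v \<in> verts A" for v
  proof (cases "finite (L v)")
    case True
    then show ?thesis using L that obtain_subset_with_card_n[of 8 "L v"] by metis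
  next
    case False
    then show ?thesis using infinite_arbitrarily_large[of "L v" 8] by blast
  qed
  then obtain M where M: "\<And>v. v \<in> verts A \<Longrightarrow> M v \<subseteq> L v \<and> finite (M v) \<and> card (M v) = 8"
    by metis
  \<comment> \<open>All edges are included, with inner rungs and diagonals, so that facial paths on
    two vertices are covered as well.\<close>
  define E where "E p q \<longleftrightarrow> p < 2 * n \<and> q < 2 * n \<and> {cyc p, cyc q} \<in> edges A" for p q
  interpret list_instance "2 * n" "\<lambda>p. M (cyc p)" E
  proof
    fix p assume p: "p < 2 * n"
    show "finite (M (cyc p))" "8 \<le> card (M (cyc p))" using M[of "cyc p"] p by (auto simp: verts_A)
    have "card {q. q < 2 * n \<and> E p q} \<le> card {e \<in> edges A. cyc p \<in> e}"
    proof (rule card_inj_on_le[where f = "\<lambda>q. {cyc p, cyc q}"])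
      show "inj_on (\<lambda>q. {cyc p, cyc q}) {q. q < 2 * n \<and> E p q}"
        using inj_on_cyc by (auto simp: inj_on_def doubleton_eq_iff)
    qed (use fin in \<open>auto simp: E_def\<close>)
    then show "card {q. q < 2 * n \<and> E p q} \<le> 4"
      using deg[of "cyc p"] p by (simp add: verts_A degree_def)
  next
    show "\<not> E p p" for p
      using edge_iff[of "cyc p" "cyc p"] by (auto simp: E_def adj_def)
  qed (auto simp: E_def insert_commute)
  obtain f where fL: "\<And>p. p < 2 * n \<Longrightarrow> f p \<in> M (cyc p)"
    and fE: "\<And>p q. p < 2 * n \<Longrightarrow> q < 2 * n \<Longrightarrow> E p q \<Longrightarrow> f p \<noteq> f q"
    and fR: "\<And>s k. s < 2 * n \<Longrightarrow> 2 \<le> k \<Longrightarrow> 2 * k \<le> 2 * n \<Longrightarrow>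
      \<exists>i<k. f ((s + i) mod (2 * n)) \<noteq> f ((s + k + i) mod (2 * n))"
    using exists_cyclic_colouring by blast
  define \<phi> where "\<phi> v = f (inv_into {..<2 * n} cyc v)" for v
  have \<phi>: "\<phi> (cyc p) = f p" if "p < 2 * n" for p
    using inv_into_f_f[OF inj_on_cyc] that by (simp add: \<phi>_def)
  have norep: False
    if F: "F \<in> faces A" and walk: "boundary_walk A F ws" "prefix xs (rotate k ws)"
      and xs: "distinct xs" "1 \<le> m" "length xs = 2 * m"
      and rep: "\<And>i. i < m \<Longrightarrow> \<phi> (xs ! i) = \<phi> (xs ! (m + i))" for F ws xs k m
  proof (cases "m = 1")
    case True
    then have "{xs ! 0, xs ! 1} \<in> edges A" using walk_nth_edge(1)[OF walk, of 0] xs by simp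
    moreover from this obtain p q where pq: "p < 2 * n" "xs ! 0 = cyc p" "q < 2 * n" "xs ! 1 = cyc q"
      unfolding edge_iff adj_def using cyc_surj by metis
    ultimately have "f p \<noteq> f q" using fE[of p q] by (simp add: E_def)
    then show False using rep[of 0] True pq \<phi> by simp
  next
    case False
    then have m: "2 \<le> m" "4 \<le> length xs" using xs by auto
    obtain s where s: "s < 2 * n" "\<And>i. i < length xs \<Longrightarrow> xs ! i = cyc ((s + i) mod (2 * n))"
      using long_path_on_outer_cycle[OF F walk xs(1) m(2)] by blast
    \<comment> \<open>The path has distinct vertices, which bounds the half-length by
      \<open>n\<close>, as \<open>fR\<close> demands.\<close>
    have "set xs \<subseteq> cyc ` {..<2 * n}"
      using s by (auto simp: in_set_conv_nth)
    then have "card (set xs) \<le> card (cyc ` {..<2 * n})" by (intro card_mono) auto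
    also have "\<dots> \<le> card {..<2 * n}" by (rule card_image_le) simp
    finally have "2 * m \<le> 2 * n" using xs by (simp add: distinct_card)
    then obtain i where i: "i < m" "f ((s + i) mod (2 * n)) \<noteq> f ((s + m + i) mod (2 * n))"
      using fR[OF s(1) m(1)] by blast
    have "xs ! i = cyc ((s + i) mod (2 * n))" "xs ! (m + i) = cyc ((s + m + i) mod (2 * n))"
      using s(2)[of i] s(2)[of "m + i"] i(1) xs by (auto simp: add.assoc)
    then show False using rep[OF i(1)] i(2) \<phi> s(1) by simp
  qed
  have "facial_nonrepetitive A \<phi>"
    unfolding facial_nonrepetitive_def
  proof (intro allI impI notI)
    fix xs assume "facial_path A xs" "repetition (map \<phi> xs)"
    then obtain F ws k where F: "F \<in> faces A" "boundary_walk A F ws"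
      and pre: "prefix xs (rotate k ws) \<or> prefix (rev xs) (rotate k ws)" and dist: "distinct xs"
      unfolding facial_path_def by blast
    obtain m where m: "1 \<le> m" "length xs = 2 * m" "\<And>i. i < m \<Longrightarrow> map \<phi> xs ! i = map \<phi> xs ! (m + i)"
      using \<open>repetition (map \<phi> xs)\<close> unfolding repetition_def length_map by blast
    note xs = dist m(1,2)
    have rep: "\<phi> (xs ! i) = \<phi> (xs ! (m + i))" if "i < m" for i using m(2) m(3)[OF that] that by simp
    from pre show False
    proof
      assume "prefix xs (rotate k ws)"
      then show False using norep F xs rep by blast
    next
      assume pre: "prefix (rev xs) (rotate k ws)"
      \<comment> \<open>Reversal swaps the two halves and sends index \<open>i\<close> to
        \<open>m - Suc i\<close>, so a repetition stays a repetition.\<close>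
      have "\<phi> (rev xs ! i) = \<phi> (rev xs ! (m + i))" if "i < m" for i
      proof -
        have "rev xs ! i = xs ! (m + (m - Suc i))" "rev xs ! (m + i) = xs ! (m - Suc i)"
          using that xs by (auto simp: rev_nth intro!: arg_cong[where f = "(!) xs"])
        then show ?thesis using rep[of "m - Suc i"] that by simp
      qed
      then show False using norep[OF F pre, of m] xs by simp
    qed
  qed
  moreover have "\<forall>v\<in>verts A. \<phi> v \<in> L v"
  proof
    fix v assume v: "v \<in> verts A"
    then obtain p where "p < 2 * n" "v = cyc p" by (auto simp: verts_A)
    then show "\<phi> v \<in> L v" using \<phi> fL M[OF v] by auto
  qed
  ultimately show "\<exists>\<phi>. facial_nonrepetitive A \<phi> \<and> (\<forall>v\<in>verts A. \<phi> v \<in> L v)" by blast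
qed

end

theorem theorem12:
  fixes n :: nat and A :: geom_graph
  assumes "n > 2" and "apic_graph n A"
  shows "pi_fl A \<le> 8"
proof -
  obtain d where d: "\<And>i. i + 1 < n \<Longrightarrow> d i \<in> diagonals i"
    and A: "A = \<lparr> verts = verts (ladder n), edges = edges (ladder n) \<union> d ` {i. i + 1 < n} \<rparr>"
    using assms(2) unfolding apic_graph_def by blast
  have "finite (edges A)"
  proof (rule finite_subset)
    show "edges A \<subseteq> Pow (verts A)" "finite (Pow (verts A))"
      using apic_graph_plane[OF assms(2)] unfolding plane_graph_def by auto
  qed
  then interpret apic n A d
    using assms d A by unfold_locales (auto simp: apic_graph_def)
  have "pi_fl A \<le> enat 8"
    unfolding pi_fl_def using facial_choosable_8 by (intro INF_lower) simp
  then show ?thesis by (simp add: numeral_eq_enat)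
qed

end
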